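(* Let $d\in\{2,4,8\}$ and let $|\varphi\rangle$ be a pure state on the Hilbert space $\mathbb{C}^d\otimes\mathbb{C}^d$ with Schmidt decomposition $|\varphi\rangle=\sum_i a_i|e_i\rangle\otimes|f_j\rangle$ with $j=i$, i.e. $|\varphi\rangle=\sum_{i=1}^d a_i|e_i\rangle\otimes|f_i\rangle$. Put $c=\max_i a_i^2$ and $k=\lfloor 1/c\rfloor$. Then $$\mathcal{M}(\varphi)\geq H(\underbrace{c,\dots,c}_{k},1-kc)=-kc\log_2 c-(1-kc)\log_2(1-kc).$$
   Context: In the Schmidt decomposition, $\{e_i\}$ and $\{f_i\}$ are orthonormal bases of $\mathbb{C}^d$ and the $a_i\ge 0$ are real with $\sum_i a_i^2=1$. $\mathcal{M}(\varphi)$ means $\mathcal{M}(|\varphi\rangle\langle\varphi|)$. $H(p_1,\dots,p_n)=-\sum_i p_i\log_2 p_i$ is the Shannon entropy, with $0\log_2 0=0$. A state is a density matrix; $\mathcal{PS}$ denotes the set of product states $\varrho_A\otimes\varrho_B$. A von Neumann measurement $\mathcal{P}=\{P_i\}$ is a complete family of mutually orthogonal rank-one projectors on $\mathbb{C}^d\otimes\mathbb{C}^d$ (not necessarily of product form) summing to the identity. The Klein entropy is $H(\varrho,\mathcal{P})=-\sum_i p_i\log_2 p_i$ with $p_i=\mathrm{Tr}(\varrho P_i)$. The entropic entanglement parameter is $$\mathcal{M}(\varrho)=\sup_{\mathcal{P}}\Big(\inf_{\delta\in\mathcal{PS}}H(\delta,\mathcal{P})-H(\varrho,\mathcal{P})\Big),$$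 the supremum being over all von Neumann measurements. *)

theory Defs
  imports "HOL-Analysis.Analysis"
begin

text \<open>
  The Hilbert space of dimension \<open>d\<close> is \<^typ>\<open>complex ^ 'n\<close> with \<open>CARD('n) = d\<close>; the tensor
  product of two copies is the space \<^typ>\<open>complex ^ ('n \<times> 'n)\<close> of coordinates with respect to
  the product basis. The library's inner product on these spaces is the real one, so the
  sesquilinear one (conjugate-linear in the first argument) is defined here.
\<close>

definition cinner :: "complex ^ 'i \<Rightarrow> complex ^ 'i \<Rightarrow> complex" where
  "cinner x y = (\<Sum>i\<in>UNIV. cnj (x $ i) * y $ i)"

definition conj_transpose :: "complex ^ 'i ^ 'j \<Rightarrow> complex ^ 'j ^ 'i" where
  "conj_transpose A = (\<chi> i j. cnj (A $ j $ i))"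

definition hermitian :: "complex ^ 'i ^ 'i \<Rightarrow> bool" where
  "hermitian A \<longleftrightarrow> conj_transpose A = A"

definition tensor_vec ::
    "complex ^ 'i \<Rightarrow> complex ^ 'j \<Rightarrow> complex ^ ('i::finite \<times> 'j::finite)" where
  "tensor_vec x y = (\<chi> p. x $ fst p * y $ snd p)"

definition tensor_mat ::
    "complex ^ 'i ^ 'i \<Rightarrow> complex ^ 'j ^ 'j \<Rightarrow>
      complex ^ ('i::finite \<times> 'j::finite) ^ ('i \<times> 'j)" where
  "tensor_mat A B = (\<chi> p q. A $ fst p $ fst q * B $ snd p $ snd q)"

definition ketbra :: "complex ^ 'i \<Rightarrow> complex ^ 'i ^ 'i" where
  "ketbra x = (\<chi> i j. x $ i * cnj (x $ j))"

definition density_matrix :: "complex ^ 'i ^ 'i \<Rightarrow> bool" where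
  "density_matrix \<rho> \<longleftrightarrow>
     hermitian \<rho> \<and> (\<forall>x. 0 \<le> Re (cinner x (\<rho> *v x))) \<and> trace \<rho> = 1"

definition product_states :: "(complex ^ ('n::finite \<times> 'n) ^ ('n \<times> 'n)) set" where
  "product_states = {tensor_mat \<rho>A \<rho>B | \<rho>A \<rho>B. density_matrix \<rho>A \<and> density_matrix \<rho>B}"

definition rank_one_projector :: "complex ^ 'i ^ 'i \<Rightarrow> bool" where
  "rank_one_projector P \<longleftrightarrow> hermitian P \<and> P ** P = P \<and> rank P = 1"

text \<open>
  A measurement is given as the set of its projectors: nonzero mutually orthogonal projectors
  are distinct, so no information is lost compared with an indexed family.
\<close>

definition von_neumann_measurement :: "(complex ^ 'i ^ 'i) set \<Rightarrow> bool" where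
  "von_neumann_measurement \<P> \<longleftrightarrow>
     finite \<P> \<and> (\<forall>P\<in>\<P>. rank_one_projector P) \<and>
     (\<forall>P\<in>\<P>. \<forall>Q\<in>\<P>. P \<noteq> Q \<longrightarrow> P ** Q = 0) \<and> (\<Sum>P\<in>\<P>. P) = mat 1"

text \<open>The convention that \<open>0 * log 2 0 = 0\<close> holds automatically in the two entropies below.\<close>

definition shannon_entropy :: "real list \<Rightarrow> real" where
  "shannon_entropy ps = - (\<Sum>p\<leftarrow>ps. p * log 2 p)"

text \<open>For density matrices and projectors the trace below is real, so \<^const>\<open>Re\<close> only changes its type.\<close>

definition outcome_prob :: "complex ^ 'i ^ 'i \<Rightarrow> complex ^ 'i ^ 'i \<Rightarrow> real" where
  "outcome_prob \<rho> P = Re (trace (\<rho> ** P))"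

definition klein_entropy :: "complex ^ 'i ^ 'i \<Rightarrow> (complex ^ 'i ^ 'i) set \<Rightarrow> real" where
  "klein_entropy \<rho> \<P> = - (\<Sum>P\<in>\<P>. outcome_prob \<rho> P * log 2 (outcome_prob \<rho> P))"

text \<open>
  For a density matrix, Klein entropies lie between \<open>0\<close> and \<open>log 2 (d\<^sup>2)\<close>, and product states and
  measurements exist; hence the real supremum and infimum below are those of nonempty
  bounded sets.
\<close>

definition entropic_entanglement :: "complex ^ ('n::finite \<times> 'n) ^ ('n \<times> 'n) \<Rightarrow> real" where
  "entropic_entanglement \<rho> =
     (SUP \<P>\<in>{\<P>. von_neumann_measurement \<P>}.
        (INF \<delta>\<in>product_states. klein_entropy \<delta> \<P>) - klein_entropy \<rho> \<P>)"

definition orthonormal_basis :: "('n \<Rightarrow> complex ^ 'n) \<Rightarrow> bool" where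
  "orthonormal_basis e \<longleftrightarrow>
     (\<forall>i j. cinner (e i) (e j) = (if i = j then 1 else 0)) \<and> vec.span (range e) = UNIV"

definition schmidt_decomposition ::
    "complex ^ ('n::finite \<times> 'n) \<Rightarrow> ('n \<Rightarrow> real) \<Rightarrow>
      ('n \<Rightarrow> complex ^ 'n) \<Rightarrow> ('n \<Rightarrow> complex ^ 'n) \<Rightarrow> bool" where
  "schmidt_decomposition \<phi> a e f \<longleftrightarrow>
     orthonormal_basis e \<and> orthonormal_basis f \<and>
     (\<forall>i. 0 \<le> a i) \<and> (\<Sum>i\<in>UNIV. (a i)\<^sup>2) = 1 \<and>
     \<phi> = (\<Sum>i\<in>UNIV. complex_of_real (a i) *s tensor_vec (e i) (f i))"

end

theory Submission
  imports Defs
begin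

text \<open>
  Use a measurement whose basis contains \<open>\<phi>\<close>, so that \<open>H(\<phi>, \<P>) = 0\<close>, and all of whose vectors have
  the same Schmidt coefficients as \<open>\<phi>\<close> up to order and sign. Such a basis is obtained by identifying
  the Schmidt index set with the group \<open>\<int>\<^sub>2\<^sup>m\<close>, \<open>m \<in> {1, 2, 3}\<close>: the vectors are
  \<open>\<Sum>\<^sub>i \<sigma>(g, i) a\<^bsub>i + g\<^esub> e\<^sub>i \<otimes> f\<^bsub>i + h\<^esub>\<close>, where the signs \<open>\<sigma>\<close> are those of the multiplication table of the
  complex numbers, the quaternions or the octonions. Every product state then gives each outcome a
  probability of at most \<open>c\<close>, and by concavity of \<open>- x log x\<close> the least entropy under this constraint
  is attained at \<open>(c, \<dots>, c, 1 - k c)\<close>.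
\<close>

section \<open>Minimal entropy of bounded probabilities\<close>

lemma xlogx_nonpos: "0 \<le> p \<Longrightarrow> p \<le> 1 \<Longrightarrow> p * log 2 p \<le> (0::real)"
  by (cases "p = 0") (auto simp: mult_nonneg_nonpos)

text \<open>From \<open>ln t \<le> t - 1\<close> at \<open>t = 1 / p\<close>. The bound is crude,
  but keeps Klein entropies uniformly bounded.\<close>

lemma xlogx_lower:
  fixes p :: real
  assumes "0 \<le> p" shows "- (1 / ln 2) \<le> p * log 2 p"
proof (cases "p = 0")
  case False
  with assms have p: "p > 0" by simp
  have "ln (1 / p) \<le> 1 / p - 1" using p by (intro ln_le_minus_one) auto
  then have "p * (- ln p) \<le> p * (1 / p - 1)"
    using p by (intro mult_left_mono) (auto simp: ln_div)
  also have "\<dots> \<le> 1" using p by (simp add: algebra_simps)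
  finally have "- 1 / ln 2 \<le> p * ln p / ln 2" by (intro divide_right_mono) auto
  then show ?thesis by (simp add: log_def)
qed simp

text \<open>Each logarithm on the left is at most \<open>log 2 (x + y)\<close>. Zero arguments are
  treated apart, as monotonicity needs positive ones.\<close>

lemma xlogx_superadditive:
  fixes x y :: real
  assumes "0 \<le> x" "0 \<le> y"
  shows "x * log 2 x + y * log 2 y \<le> (x + y) * log 2 (x + y)"
proof (cases "x = 0 \<or> y = 0")
  case False
  then have "log 2 x \<le> log 2 (x + y)" "log 2 y \<le> log 2 (x + y)" using assms by simp_all
  then have "x * log 2 x + y * log 2 y \<le> x * log 2 (x + y) + y * log 2 (x + y)"
    using assms by (intro add_mono mult_left_mono) auto
  then show ?thesis by (simp add: algebra_simps)
qed auto

text \<open>The derivative increases. The domain leaves out 0, where there is no derivative.\<close>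

lemma convex_on_xlogx: "convex_on {0<..} (\<lambda>x::real. x * log 2 x)"
proof (rule convex_on_realI)
  fix x y :: real
  assume "x \<in> {0<..}" "y \<in> {0<..}" "x \<le> y"
  then show "log 2 x + 1 / ln 2 \<le> log 2 y + 1 / ln 2" by simp
next
  fix x :: real assume "x \<in> {0<..}"
  then show "((\<lambda>x. x * log 2 x) has_real_derivative log 2 x + 1 / ln 2) (at x)"
    by (auto simp: log_def add_divide_distrib intro!: derivative_eq_intros)
qed auto

text \<open>Convexity: with the sum fixed, moving \<open>r\<close> and \<open>p\<close> apart until
  one reaches \<open>c\<close> can only increase the sum of the \<open>x log x\<close>
  terms.\<close>

lemma xlogx_spread:
  fixes r p c :: real
  assumes "0 \<le> r" "r \<le> c" "0 \<le> p" "p \<le> c" "c \<le> r + p"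
  shows "r * log 2 r + p * log 2 p \<le> c * log 2 c + (r + p - c) * log 2 (r + p - c)"
proof (cases "r + p = c")
  case True
  \<comment> \<open>The smaller end point is 0 here, outside the domain of convexity.\<close>
  then show ?thesis using xlogx_superadditive[of r p] assms by simp
next
  case False
  define x where "x = r + p - c"
  have x: "0 < x" using False assms by (simp add: x_def)
  show ?thesis
  proof (cases "x = c")
    case True
    then have "r = c" "p = c" using assms by (auto simp: x_def)
    then show ?thesis by simp
  next
    case False
    then have xc: "x < c" using assms by (simp add: x_def)
    \<comment> \<open>\<open>t\<close> is the position of \<open>r\<close> between \<open>x\<close>
      and \<open>c\<close>; as \<open>r + p = x + c\<close>, the position of \<open>p\<close> is
      \<open>1 - t\<close>.\<close>
    define t where "t = (r - x) / (c - x)"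
    have t: "0 \<le> t" "t \<le> 1" using assms xc by (auto simp: t_def x_def field_simps)
    have t': "t * (c - x) = r - x" using xc by (simp add: t_def)
    have r: "(1 - t) *\<^sub>R x + t *\<^sub>R c = r" and p: "(1 - (1 - t)) *\<^sub>R x + (1 - t) *\<^sub>R c = p"
      using t' by (auto simp: algebra_simps x_def)
    have "r * log 2 r \<le> (1 - t) * (x * log 2 x) + t * (c * log 2 c)"
      using convex_onD[OF convex_on_xlogx, of t x c] t x xc by (simp only: r) simp
    moreover have "p * log 2 p \<le> (1 - (1 - t)) * (x * log 2 x) + (1 - t) * (c * log 2 c)"
      using convex_onD[OF convex_on_xlogx, of "1 - t" x c] t x xc by (simp only: p) simp
    ultimately have "r * log 2 r + p * log 2 p \<le> c * log 2 c + x * log 2 x"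
      by (simp add: algebra_simps)
    then show ?thesis by (simp add: x_def)
  qed
qed

text \<open>Induction over the number of outcomes: adding a probability \<open>p \<le> c\<close> either enlarges the
  remainder \<open>r\<close> or completes one more block of size \<open>c\<close>.\<close>

lemma sum_xlogx_le_blocks:
  fixes p :: "'a \<Rightarrow> real"
  assumes "finite I" "\<And>i. i \<in> I \<Longrightarrow> 0 \<le> p i \<and> p i \<le> c" "0 < c"
  shows "\<exists>m r. sum p I = of_nat m * c + r \<and> 0 \<le> r \<and> r < c \<and>
    (\<Sum>i\<in>I. p i * log 2 (p i)) \<le> of_nat m * (c * log 2 c) + r * log 2 r"
  using assms(1,2)
proof (induction I)
  case empty
  then show ?case using assms(3) by (intro exI[of _ 0] exI[of _ 0]) auto
next
  case (insert j I)
  then obtain m r where IH: "sum p I = of_nat m * c + r" "0 \<le> r" "r < c"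
    "(\<Sum>i\<in>I. p i * log 2 (p i)) \<le> of_nat m * (c * log 2 c) + r * log 2 r" by auto
  have pj: "0 \<le> p j" "p j \<le> c" using insert.prems by auto
  show ?case
  proof (cases "r + p j < c")
    case True
    then show ?thesis using IH insert.hyps pj xlogx_superadditive[of r "p j"]
      by (intro exI[of _ m] exI[of _ "r + p j"]) auto
  next
    case False
    then show ?thesis using IH insert.hyps pj xlogx_spread[of r c "p j"]
      by (intro exI[of _ "Suc m"] exI[of _ "r + p j - c"]) (auto simp: algebra_simps)
  qed
qed

text \<open>A total of 1 fixes the number of blocks: \<open>1 / c = m + r / c\<close> with
  \<open>0 \<le> r / c < 1\<close> makes \<open>m\<close> the floor.\<close>

lemma sum_xlogx_le:
  fixes p :: "'a \<Rightarrow> real"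
  assumes "finite I" "\<And>i. i \<in> I \<Longrightarrow> 0 \<le> p i" "\<And>i. i \<in> I \<Longrightarrow> p i \<le> c" "0 < c"
    and "sum p I = 1" "k = nat \<lfloor>1 / c\<rfloor>"
  shows "(\<Sum>i\<in>I. p i * log 2 (p i)) \<le>
    real k * c * log 2 c + (1 - real k * c) * log 2 (1 - real k * c)"
proof -
  obtain m r where mr: "1 = real m * c + r" "0 \<le> r" "r < c"
    "(\<Sum>i\<in>I. p i * log 2 (p i)) \<le> of_nat m * (c * log 2 c) + r * log 2 r"
    using sum_xlogx_le_blocks[of I p c] assms by auto
  have "1 / c = real m + r / c" using mr(1) \<open>0 < c\<close> by (simp add: field_simps)
  moreover have "0 \<le> r / c" "r / c < 1" using mr \<open>0 < c\<close> by auto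
  ultimately have "\<lfloor>1 / c\<rfloor> = int m" by (intro floor_unique) auto
  then have "k = m" using assms(6) by simp
  moreover have "r = 1 - real m * c" using mr(1) by simp
  ultimately show ?thesis using mr(4) by (simp add: mult.assoc)
qed

lemma shannon_entropy_blocks:
  "shannon_entropy (replicate k c @ [q]) = - real k * c * log 2 c - q * log 2 q"
  by (simp add: shannon_entropy_def sum_list_replicate)

section \<open>Signs from the octonions\<close>

text \<open>Writing \<open>u\<^sub>0, \<dots>, u\<^sub>7\<close> for the octonion units in the Cayley-Dickson numbering, the entry \<open>(g, i)\<close>
  is the sign of \<open>u\<^sub>j u\<^sub>g = \<plusminus> u\<^sub>i\<close> with \<open>j = i xor g\<close>. The complex numbers and the quaternions are the
  top left blocks of sizes 2 and 4, and the index sets \<open>{0..<2}\<close> and \<open>{0..<4}\<close> are closed under xor.\<close>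

definition octonion_signs :: "int list list" where
  "octonion_signs =
    [[ 1,  1,  1,  1,  1,  1,  1,  1],
     [-1,  1,  1, -1,  1, -1, -1,  1],
     [-1, -1,  1,  1,  1,  1, -1, -1],
     [-1,  1, -1,  1,  1, -1,  1, -1],
     [-1, -1, -1, -1,  1,  1,  1,  1],
     [-1,  1, -1,  1, -1,  1, -1,  1],
     [-1,  1,  1, -1, -1,  1,  1, -1],
     [-1, -1,  1,  1, -1, -1,  1,  1]]"

text \<open>The involution \<open>i \<mapsto> xor i (xor g h)\<close> will pair equal products of
  coefficients; the opposite signs found here make them cancel, so distinct rows give orthogonal
  vectors.\<close>

lemma octonion_signs_check:
  "\<forall>g\<in>set [0..<8]. \<forall>h\<in>set [0..<8]. g \<noteq> h \<longrightarrow> (\<forall>i\<in>set [0..<8].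
     octonion_signs ! g ! i * octonion_signs ! h ! i =
     - (octonion_signs ! g ! xor i (xor g h) * octonion_signs ! h ! xor i (xor g h)))"
  by code_simp

lemma octonion_signs_range:
  "\<forall>g\<in>set [0..<8]. \<forall>i\<in>set [0..<8]. octonion_signs ! g ! i = 1 \<or> octonion_signs ! g ! i = - 1"
  by code_simp

lemma octonion_signs_first: "\<forall>i\<in>set [0..<8]. octonion_signs ! 0 ! i = 1"
  by code_simp

lemma xor_less_check:
  "\<forall>d\<in>set [2, 4, 8]. \<forall>g\<in>set [0..<d]. \<forall>h\<in>set [0..<d]. xor g h < (d::nat)"
  by code_simp

text \<open>The index type has no structure of its own, so an enumeration \<open>b\<close> carries
  xor and the sign table over to it.\<close>

lemma ex_sign_group:
  assumes "CARD('n::finite) \<in> {2, 4, 8}"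
  obtains oplus :: "'n::finite \<Rightarrow> 'n \<Rightarrow> 'n" and z :: "'n::finite"
    and s :: "'n::finite \<Rightarrow> 'n \<Rightarrow> real"
  where "\<And>x. oplus x z = x" "\<And>x y. oplus x y = oplus y x"
    "\<And>x y w. oplus (oplus x y) w = oplus x (oplus y w)" "\<And>x. oplus x x = z"
    "\<And>g i. (s g i)\<^sup>2 = 1" "\<And>i. s z i = 1"
    "\<And>g h i. g \<noteq> h \<Longrightarrow>
       s g i * s h i = - (s g (oplus i (oplus g h)) * s h (oplus i (oplus g h)))"
proof -
  obtain b :: "'n \<Rightarrow> nat" where "bij_betw b UNIV {0..<CARD('n)}"
    using ex_bij_betw_finite_nat[of "UNIV :: 'n set"] by auto
  then have inj: "inj b" and ran: "range b = {0..<CARD('n)}" by (auto simp: bij_betw_def)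
  have b_lt: "b x < CARD('n)" for x using ran by auto
  have "CARD('n) \<le> 8" using assms by auto
  then have b8: "b x \<in> set [0..<8]" for x using b_lt[of x] by simp
  define oplus where "oplus x y = inv b (xor (b x) (b y))" for x y
  define z where "z = inv b 0"
  define s where "s g i = real_of_int (octonion_signs ! b g ! b i)" for g i
  have xor_lt: "xor (b x) (b y) < CARD('n)" for x y
  proof -
    have "CARD('n) \<in> set [2, 4, 8]" using assms by simp
    moreover have "b x \<in> set [0..<CARD('n)]" "b y \<in> set [0..<CARD('n)]"
      using b_lt[of x] b_lt[of y] by simp_all
    ultimately show ?thesis using xor_less_check by blast
  qed
  have b_oplus: "b (oplus x y) = xor (b x) (b y)" for x y
    using xor_lt[of x y] ran by (auto simp: oplus_def intro!: f_inv_into_f)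
  have b_z: "b z = 0" using ran by (auto simp: z_def intro!: f_inv_into_f)
  show thesis
  proof (rule that[of oplus z s])
    show "oplus x z = x" for x by (rule injD[OF inj]) (simp add: b_oplus b_z)
    show "oplus x y = oplus y x" for x y
      by (rule injD[OF inj]) (simp add: b_oplus xor.commute)
    show "oplus (oplus x y) w = oplus x (oplus y w)" for x y w
      by (rule injD[OF inj]) (simp add: b_oplus xor.assoc)
    show "oplus x x = z" for x by (rule injD[OF inj]) (simp add: b_oplus b_z)
    show "(s g i)\<^sup>2 = 1" for g i
    proof -
      have "octonion_signs ! b g ! b i = 1 \<or> octonion_signs ! b g ! b i = - 1"
        using octonion_signs_range b8[of g] b8[of i] by blast
      then show ?thesis unfolding s_def by (elim disjE) simp_all
    qed
    show "s z i = 1" for i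
      unfolding s_def b_z using bspec[OF octonion_signs_first b8[of i]] by simp
    show "s g i * s h i = - (s g (oplus i (oplus g h)) * s h (oplus i (oplus g h)))"
      if "g \<noteq> h" for g h i
    proof -
      have "b g \<noteq> b h" using inj that by (auto dest: injD)
      then have "octonion_signs ! b g ! b i * octonion_signs ! b h ! b i =
          - (octonion_signs ! b g ! b (oplus i (oplus g h)) *
             octonion_signs ! b h ! b (oplus i (oplus g h)))"
        using octonion_signs_check b8[of g] b8[of h] b8[of i] unfolding b_oplus by blast
      then show ?thesis unfolding s_def by (metis of_int_minus of_int_mult)
    qed
  qed
qed

text \<open>The vector \<open>v g\<close> consists of the coordinates of the product of the complex number, quaternion or
  octonion with coordinates \<open>a\<close> and the \<open>g\<close>-th unit.\<close>

lemma ex_signed_permutation_frame: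
  fixes a :: "'n::finite \<Rightarrow> real"
  assumes "CARD('n) \<in> {2, 4, 8}"
  obtains oplus :: "'n \<Rightarrow> 'n \<Rightarrow> 'n" and z :: 'n and v :: "'n \<Rightarrow> 'n \<Rightarrow> real"
  where "\<And>x. oplus x z = x" "\<And>x. inj (oplus x)" "\<And>x. inj (\<lambda>y. oplus y x)"
    "v z = a" "\<And>g i. \<exists>j. (v g i)\<^sup>2 = (a j)\<^sup>2"
    "\<And>g h. (\<Sum>i\<in>UNIV. v g i * v h i) = (if g = h then \<Sum>i\<in>UNIV. (a i)\<^sup>2 else 0)"
proof -
  obtain oplus :: "'n \<Rightarrow> 'n \<Rightarrow> 'n" and z :: 'n and s :: "'n \<Rightarrow> 'n \<Rightarrow> real"
    where G: "\<And>x. oplus x z = x" "\<And>x y. oplus x y = oplus y x"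
    "\<And>x y w. oplus (oplus x y) w = oplus x (oplus y w)" "\<And>x. oplus x x = z"
    and s: "\<And>g i. (s g i)\<^sup>2 = 1" "\<And>i. s z i = 1"
    "\<And>g h i. g \<noteq> h \<Longrightarrow>
       s g i * s h i = - (s g (oplus i (oplus g h)) * s h (oplus i (oplus g h)))"
    by (rule ex_sign_group[OF assms]) (rule that)
  \<comment> \<open>Each element is its own inverse, so every translation is an involution.\<close>
  have cancel: "oplus (oplus y x) x = y" for x y by (simp add: G(1,3,4))
  have bij: "bij (\<lambda>y. oplus y x)" for x
    by (rule bij_betw_byWitness[of _ "\<lambda>y. oplus y x"]) (auto simp: cancel)
  define v where "v g i = s g i * a (oplus i g)" for g i
  show thesis
  proof (rule that[of oplus z v])
    show "oplus x z = x" for x by (rule G)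
    show inj: "inj (\<lambda>y. oplus y x)" for x using bij by (rule bij_is_inj)
    show "inj (oplus x)" for x using inj[of x] by (simp add: inj_def G(2)[of x])
    show "v z = a" by (simp add: v_def G(1) s fun_eq_iff)
    show "\<exists>j. (v g i)\<^sup>2 = (a j)\<^sup>2" for g i by (auto simp: v_def power_mult_distrib s)
    show "(\<Sum>i\<in>UNIV. v g i * v h i) = (if g = h then \<Sum>i\<in>UNIV. (a i)\<^sup>2 else 0)" for g h
    proof (cases "g = h")
      case True
      have "(\<Sum>i\<in>UNIV. v g i * v g i) = (\<Sum>i\<in>UNIV. (a (oplus i g))\<^sup>2)"
        unfolding power2_eq_square[symmetric] by (simp add: v_def power_mult_distrib s)
      also have "\<dots> = (\<Sum>i\<in>UNIV. (a i)\<^sup>2)"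
        using sum.reindex_bij_betw[OF bij, of "\<lambda>i. (a i)\<^sup>2" g] by simp
      finally show ?thesis using True by simp
    next
      case False
      \<comment> \<open>Translation by \<open>t\<close> swaps the coefficients at
        \<open>oplus i g\<close> and \<open>oplus i h\<close> and reverses the product of signs, so
        the inner product equals its own negative.\<close>
      define t where "t = oplus g h"
      have "oplus t g = h" "oplus t h = g"
        using cancel[of h g] cancel[of g h] unfolding t_def by (simp_all only: G(2)[of h g])
      then have at: "oplus (oplus i t) g = oplus i h" "oplus (oplus i t) h = oplus i g" for i
        by (simp_all only: G(3))
      have "v g (oplus i t) * v h (oplus i t) = - (v g i * v h i)" for i
      proof -
        have "v g (oplus i t) * v h (oplus i t) =
            (s g (oplus i t) * s h (oplus i t)) * (a (oplus i h) * a (oplus i g))"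
          by (simp only: v_def at mult_ac)
        also have "s g (oplus i t) * s h (oplus i t) = - (s g i * s h i)"
          using s(3)[OF False, of i] by (simp add: t_def)
        finally show ?thesis by (simp add: v_def)
      qed
      then have "(\<Sum>i\<in>UNIV. v g i * v h i) = - (\<Sum>i\<in>UNIV. v g i * v h i)"
        using sum.reindex_bij_betw[OF bij, of "\<lambda>i. v g i * v h i" t]
        by (simp add: sum_negf)
      then show ?thesis using False by simp
    qed
  qed
qed

section \<open>Positive semidefinite matrices and product states\<close>

lemma sum_UNIV_prod:
  fixes g :: "'a::finite \<times> 'b::finite \<Rightarrow> 'c::comm_monoid_add"
  shows "(\<Sum>p\<in>UNIV. g p) = (\<Sum>i\<in>UNIV. \<Sum>j\<in>UNIV. g (i, j))"
  by (simp add: sum.cartesian_product)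

section \<open>Sesquilinear inner product and Hermitian matrices\<close>

lemma cinner_add_left: "cinner (x + y) z = cinner x z + cinner y z"
  by (simp add: cinner_def sum.distrib algebra_simps)

lemma cinner_add_right: "cinner x (y + z) = cinner x y + cinner x z"
  by (simp add: cinner_def sum.distrib algebra_simps)

lemma cinner_diff_right: "cinner x (y - z) = cinner x y - cinner x z"
  by (simp add: cinner_def sum_subtractf algebra_simps)

lemma cinner_scale_left: "cinner (t *s x) y = cnj t * cinner x y"
  by (simp add: cinner_def sum_distrib_left mult.assoc)

lemma cinner_scale_right: "cinner x (t *s y) = t * cinner x y"
  by (simp add: cinner_def sum_distrib_left mult_ac)

lemma cinner_zero [simp]: "cinner 0 y = 0" "cinner x 0 = 0"
  by (simp_all add: cinner_def)

lemma cinner_sum_left: "cinner (\<Sum>i\<in>I. u i) y = (\<Sum>i\<in>I. cinner (u i) y)"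
  by (induction I rule: infinite_finite_induct) (auto simp: cinner_add_left)

lemma cinner_sum_right: "cinner x (\<Sum>i\<in>I. u i) = (\<Sum>i\<in>I. cinner x (u i))"
  by (induction I rule: infinite_finite_induct) (auto simp: cinner_add_right)

lemma cnj_cinner: "cnj (cinner x y) = cinner y x"
  by (simp add: cinner_def mult.commute)

lemma cinner_mult_cnj: "cinner x y * cinner y x = of_real ((cmod (cinner x y))\<^sup>2)"
  by (metis cnj_cinner complex_norm_square)

lemma cinner_axis: "cinner (axis i 1) y = y $ i"
proof -
  have "cinner (axis i 1) y = (\<Sum>j\<in>UNIV. if j = i then y $ j else 0)"
    unfolding cinner_def by (intro sum.cong) (auto simp: axis_def)
  then show ?thesis by simp
qed

lemma cinner_matrix_axis: "cinner (axis i 1) (A *v axis j 1) = A $ i $ j"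
  unfolding cinner_axis by (simp add: matrix_vector_mult_def axis_def if_distrib cong: if_cong)

lemma hermitian_iff: "hermitian A \<longleftrightarrow> (\<forall>i j. cnj (A $ i $ j) = A $ j $ i)"
  by (auto simp: hermitian_def conj_transpose_def vec_eq_iff)

lemma hermitian_entry: "hermitian A \<Longrightarrow> cnj (A $ i $ j) = A $ j $ i"
  by (simp add: hermitian_def conj_transpose_def vec_eq_iff)

lemma cinner_matrix:
  "cinner x (A *v y) = (\<Sum>i\<in>UNIV. \<Sum>j\<in>UNIV. cnj (x $ i) * A $ i $ j * y $ j)"
  by (simp add: cinner_def matrix_vector_mult_def sum_distrib_left mult.assoc)

lemma cinner_hermitian:
  assumes "hermitian A"
  shows "cinner y (A *v x) = cnj (cinner x (A *v y))"
proof -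
  have "cnj (cinner x (A *v y)) = (\<Sum>i\<in>UNIV. \<Sum>j\<in>UNIV. x $ i * A $ j $ i * cnj (y $ j))"
    by (simp add: cinner_matrix hermitian_entry[OF assms])
  also have "\<dots> = cinner y (A *v x)"
    unfolding cinner_matrix by (subst sum.swap) (simp add: mult_ac)
  finally show ?thesis by simp
qed

text \<open>A density matrix without its normalisation, since the elimination below changes the
  trace.\<close>

definition positive_semidefinite :: "complex ^ 'i ^ 'i \<Rightarrow> bool" where
  "positive_semidefinite A \<longleftrightarrow> hermitian A \<and> (\<forall>x. 0 \<le> Re (cinner x (A *v x)))"

lemma cinner_hermitian_real:
  assumes "hermitian A"
  shows "cinner x (A *v x) = of_real (Re (cinner x (A *v x)))"
  using cinner_hermitian[OF assms, of x x] by (simp add: complex_eq_iff)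

text \<open>The form is nonnegative at \<open>x + t *s y\<close>; taking
  \<open>t = - s * cnj \<gamma>\<close> makes the cross terms real and leaves a quadratic in the
  real number \<open>s\<close>.\<close>

lemma positive_semidefinite_Cauchy_Schwarz:
  assumes "positive_semidefinite A"
  shows "(cmod (cinner x (A *v y)))\<^sup>2 \<le> Re (cinner x (A *v x)) * Re (cinner y (A *v y))"
proof -
  define \<alpha> where "\<alpha> = Re (cinner x (A *v x))"
  define \<beta> where "\<beta> = Re (cinner y (A *v y))"
  define \<gamma> where "\<gamma> = cinner x (A *v y)"
  have h: "hermitian A" and pos: "0 \<le> Re (cinner z (A *v z))" for z
    using assms by (auto simp: positive_semidefinite_def)
  have \<alpha>: "cinner x (A *v x) = of_real \<alpha>" and \<beta>: "cinner y (A *v y) = of_real \<beta>"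
    unfolding \<alpha>_def \<beta>_def by (rule cinner_hermitian_real[OF h])+
  have ineq: "0 \<le> \<alpha> - 2 * s * (cmod \<gamma>)\<^sup>2 + s\<^sup>2 * (cmod \<gamma>)\<^sup>2 * \<beta>" for s :: real
  proof -
    define t where "t = - of_real s * cnj \<gamma>"
    have "cinner (x + t *s y) (A *v (x + t *s y)) =
        cinner x (A *v x) + t * \<gamma> + cnj t * cnj \<gamma> + cnj t * t * cinner y (A *v y)"
      by (simp add: matrix_vector_right_distrib vector_scalar_commute cinner_add_left
          cinner_add_right cinner_scale_left cinner_scale_right \<gamma>_def
          cinner_hermitian[OF h, of y x] algebra_simps)
    also have "\<dots> = of_real (\<alpha> - 2 * s * (cmod \<gamma>)\<^sup>2 + s\<^sup>2 * (cmod \<gamma>)\<^sup>2 * \<beta>)"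
      unfolding \<alpha> \<beta> t_def
      by (simp add: complex_norm_square power2_eq_square[of s] algebra_simps del: of_real_power)
    finally show ?thesis using pos[of "x + t *s y"] by simp
  qed
  have "(cmod \<gamma>)\<^sup>2 \<le> \<alpha> * \<beta>"
  proof (cases "\<beta> = 0")
    case True
    have "(cmod \<gamma>)\<^sup>2 \<le> 0"
    proof (rule ccontr)
      assume "\<not> (cmod \<gamma>)\<^sup>2 \<le> 0"
      then have "0 < (cmod \<gamma>)\<^sup>2" by simp
      \<comment> \<open>For \<open>\<beta> = 0\<close> the bound is linear in \<open>s\<close>, and
        this choice gives it the value \<open>-1\<close>.\<close>
      then show False using ineq[of "(\<alpha> + 1) / (2 * (cmod \<gamma>)\<^sup>2)"] pos[of x] True
        by (simp add: \<alpha>_def)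
    qed
    then show ?thesis using True by simp
  next
    case False
    then have "0 < \<beta>" using pos[of y] by (simp add: \<beta>_def)
    \<comment> \<open>The quadratic in \<open>s\<close> is least at
      \<open>1 / \<beta>\<close>.\<close>
    then show ?thesis using ineq[of "1 / \<beta>"]
      by (simp add: power2_eq_square field_simps)
  qed
  then show ?thesis by (simp add: \<alpha>_def \<beta>_def \<gamma>_def)
qed

lemma ketbra_mult_vec: "ketbra u *v x = cinner u x *s u"
  by (simp add: vec_eq_iff ketbra_def matrix_vector_mult_def cinner_def sum_distrib_right
      sum_distrib_left mult_ac)

lemma hermitian_ketbra: "hermitian (ketbra u)"
  by (simp add: hermitian_def conj_transpose_def ketbra_def vec_eq_iff)

lemma positive_semidefinite_ketbra: "positive_semidefinite (ketbra u)"
proof -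
  have "cinner x (ketbra u *v x) = of_real ((cmod (cinner u x))\<^sup>2)" for x
    by (simp add: ketbra_mult_vec cinner_scale_right cinner_mult_cnj del: of_real_power)
  then show ?thesis by (simp add: positive_semidefinite_def hermitian_ketbra)
qed

lemma trace_mult_ketbra: "trace (A ** ketbra u) = cinner u (A *v u)"
  by (simp add: trace_def matrix_matrix_mult_def ketbra_def cinner_matrix mult_ac)

lemma trace_ketbra: "trace (ketbra u) = cinner u u"
  by (simp add: trace_def ketbra_def cinner_def mult.commute)

lemma density_matrix_iff: "density_matrix A \<longleftrightarrow> positive_semidefinite A \<and> trace A = 1"
  by (auto simp: density_matrix_def positive_semidefinite_def)

lemma density_matrix_ketbra: "cinner u u = 1 \<Longrightarrow> density_matrix (ketbra u)"
  by (simp add: density_matrix_iff positive_semidefinite_ketbra trace_ketbra)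

text \<open>Cholesky elimination: subtracting \<open>ketbra\<close> of a normalised column clears one row and column,
  and the remainder stays positive by the Cauchy-Schwarz inequality.\<close>

lemma positive_semidefinite_sum_ketbra_on:
  assumes "finite S" "positive_semidefinite A" "\<And>i j. i \<notin> S \<or> j \<notin> S \<Longrightarrow> A $ i $ j = 0"
  shows "\<exists>x. A = (\<Sum>k\<in>S. ketbra (x k))"
  using assms
proof (induction S arbitrary: A)
  case empty
  then show ?case by (simp add: vec_eq_iff)
next
  case (insert m S)
  have h: "hermitian A" and pos: "\<And>z. 0 \<le> Re (cinner z (A *v z))"
    using insert.prems(1) by (auto simp: positive_semidefinite_def)
  define \<mu> where "\<mu> = Re (A $ m $ m)"
  have \<mu>: "A $ m $ m = of_real \<mu>" "0 \<le> \<mu>"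
    using cinner_hermitian_real[OF h, of "axis m 1"] pos[of "axis m 1"]
    by (auto simp: cinner_matrix_axis \<mu>_def)
  have CS: "(cmod (cinner z (A *v axis m 1)))\<^sup>2 \<le> Re (cinner z (A *v z)) * \<mu>" for z
    using positive_semidefinite_Cauchy_Schwarz[OF insert.prems(1), of z "axis m 1"]
    by (simp add: cinner_matrix_axis \<mu>_def)
  \<comment> \<open>If \<open>\<mu> = 0\<close>, division by zero makes \<open>w = 0\<close>; the
    column to be cleared then vanishes already, as \<open>row\<close> shows.\<close>
  define w :: "complex ^ 'a" where "w = (1 / of_real (sqrt \<mu>)) *s (A *v axis m 1)"
  define C where "C = A - ketbra w"
  have w: "w $ i = A $ i $ m / of_real (sqrt \<mu>)" for i
    by (simp add: w_def cinner_axis[symmetric] cinner_matrix_axis cinner_scale_right)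
  have row: "A $ i $ m = 0" "A $ m $ i = 0" if "\<mu> = 0" for i
  proof -
    show "A $ i $ m = 0" using CS[of "axis i 1"] that by (simp add: cinner_matrix_axis)
    then show "A $ m $ i = 0" using hermitian_entry[OF h, of i m] by simp
  qed
  have sq: "of_real (sqrt \<mu>) * of_real (sqrt \<mu>) = (of_real \<mu> :: complex)"
    using \<mu>(2) by (simp flip: of_real_mult)
  have C_entry: "C $ i $ j = A $ i $ j - A $ i $ m * A $ m $ j / of_real \<mu>" for i j
    by (simp add: C_def ketbra_def w hermitian_entry[OF h] sq)
  have "positive_semidefinite C"
    unfolding positive_semidefinite_def
  proof (intro conjI allI)
    show "hermitian C"
      by (simp add: hermitian_def conj_transpose_def vec_eq_iff C_entry hermitian_entry[OF h] mult.commute)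
    fix z
    have "C *v z = A *v z - cinner w z *s w"
      by (simp add: C_def matrix_vector_mult_diff_rdistrib ketbra_mult_vec)
    then have "cinner z (C *v z) = cinner z (A *v z) - of_real ((cmod (cinner z w))\<^sup>2)"
      using cinner_mult_cnj[of z w] by (simp add: cinner_diff_right cinner_scale_right mult.commute)
    moreover have "(cmod (cinner z w))\<^sup>2 \<le> Re (cinner z (A *v z))"
    proof (cases "\<mu> = 0")
      case True
      then have "w = 0" by (simp add: vec_eq_iff w)
      then show ?thesis using pos by simp
    next
      case False
      have "(cmod (cinner z w))\<^sup>2 = (cmod (cinner z (A *v axis m 1)))\<^sup>2 / \<mu>"
        using \<mu>(2) by (simp add: w_def cinner_scale_right norm_mult norm_divide power_divide)
      then show ?thesis using CS[of z] False \<mu>(2) by (simp add: pos_divide_le_eq)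
    qed
    ultimately show "0 \<le> Re (cinner z (C *v z))" by simp
  qed
  moreover have "C $ i $ j = 0" if "i \<notin> S \<or> j \<notin> S" for i j
  proof (cases "\<mu> = 0")
    case True
    then show ?thesis using that row insert.prems(2)[of i j]
      by (cases "i = m \<or> j = m") (auto simp: C_entry)
  next
    case False
    then show ?thesis using that insert.prems(2)[of i j] insert.prems(2)[of i m] insert.prems(2)[of m j]
      by (cases "i = m \<or> j = m") (auto simp: C_entry \<mu>(1))
  qed
  ultimately obtain x where x: "C = (\<Sum>k\<in>S. ketbra (x k))" using insert.IH by blast
  have "(\<Sum>k\<in>S. ketbra ((x(m := w)) k)) = (\<Sum>k\<in>S. ketbra (x k))"
    using insert.hyps by (intro sum.cong) auto
  then have "(\<Sum>k\<in>insert m S. ketbra ((x(m := w)) k)) = ketbra w + C"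
    using insert.hyps by (simp add: x)
  then have "A = (\<Sum>k\<in>insert m S. ketbra ((x(m := w)) k))" by (simp add: C_def)
  then show ?case by blast
qed

lemma positive_semidefinite_sum_ketbra:
  fixes A :: "complex ^ 'i ^ 'i"
  assumes "positive_semidefinite A"
  obtains x :: "'i \<Rightarrow> complex ^ 'i" where "A = (\<Sum>k\<in>UNIV. ketbra (x k))"
  using positive_semidefinite_sum_ketbra_on[of UNIV A] assms by auto

section \<open>Tensor products of matrices and vectors\<close>

lemma tensor_mat_mult_tensor_vec:
  "tensor_mat A B *v tensor_vec x y = tensor_vec (A *v x) (B *v y)"
  by (simp add: vec_eq_iff tensor_mat_def tensor_vec_def matrix_vector_mult_def sum_UNIV_prod
      sum_product mult_ac)

lemma cinner_tensor_vec:
  "cinner (tensor_vec x y) (tensor_vec x' y') = cinner x x' * cinner y y'"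
  by (simp add: tensor_vec_def cinner_def sum_UNIV_prod sum_product mult_ac)

lemma trace_tensor_mat: "trace (tensor_mat A B) = trace A * trace B"
  by (simp add: trace_def tensor_mat_def sum_UNIV_prod sum_product)

lemma tensor_mat_sum_left:
  "tensor_mat (\<Sum>k\<in>K. A k) B = (\<Sum>k\<in>K. tensor_mat (A k) B)"
  by (simp add: vec_eq_iff tensor_mat_def sum_distrib_right)

lemma matrix_vector_mult_sum_left:
  fixes A :: "'k \<Rightarrow> complex ^ 'i ^ 'j"
  shows "(\<Sum>k\<in>K. A k) *v x = (\<Sum>k\<in>K. A k *v x)"
  by (induction K rule: infinite_finite_induct) (auto simp: matrix_vector_mult_add_rdistrib)

lemma matrix_vector_mult_sum_right:
  fixes A :: "complex ^ 'i ^ 'j"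
  shows "A *v (\<Sum>k\<in>K. x k) = (\<Sum>k\<in>K. A *v x k)"
  by (induction K rule: infinite_finite_induct) (auto simp: matrix_vector_right_distrib)

text \<open>\<open>w u\<close> contracts the first tensor factor of \<open>u\<close> with
  \<open>x\<close>, which reduces the form to one of \<open>B\<close> alone.\<close>

lemma cinner_tensor_ketbra:
  fixes x :: "complex ^ 'n::finite" and B :: "complex ^ 'm ^ 'm::finite"
  defines "w \<equiv> \<lambda>u. (\<chi> j. \<Sum>i\<in>UNIV. cnj (x $ i) * u $ (i, j))"
  shows "cinner u (tensor_mat (ketbra x) B *v u) = cinner (w u) (B *v w u)"
proof -
  define T where "T i j i' j' =
    x $ i * cnj (u $ (i, j)) * B $ j $ j' * (cnj (x $ i') * u $ (i', j'))" for i j i' j'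
  have "cinner u (tensor_mat (ketbra x) B *v u) =
      (\<Sum>i\<in>UNIV. \<Sum>j\<in>UNIV. \<Sum>i'\<in>UNIV. \<Sum>j'\<in>UNIV. T i j i' j')"
    by (simp add: cinner_matrix sum_UNIV_prod tensor_mat_def ketbra_def T_def mult_ac)
  \<comment> \<open>Moving \<open>j\<close> and \<open>j'\<close> outwards lets the sums over
    \<open>i\<close> and \<open>i'\<close> factor into entries of \<open>w u\<close> and their
    conjugates.\<close>
  also have "\<dots> = (\<Sum>j\<in>UNIV. \<Sum>i\<in>UNIV. \<Sum>i'\<in>UNIV. \<Sum>j'\<in>UNIV. T i j i' j')"
    by (rule sum.swap)
  also have "\<dots> = (\<Sum>j\<in>UNIV. \<Sum>i\<in>UNIV. \<Sum>j'\<in>UNIV. \<Sum>i'\<in>UNIV. T i j i' j')"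
    by (intro sum.cong refl sum.swap)
  also have "\<dots> = (\<Sum>j\<in>UNIV. \<Sum>j'\<in>UNIV. \<Sum>i\<in>UNIV. \<Sum>i'\<in>UNIV. T i j i' j')"
    by (intro sum.cong refl sum.swap)
  also have "\<dots> = cinner (w u) (B *v w u)"
    by (simp add: cinner_matrix w_def sum_product sum_distrib_left sum_distrib_right T_def mult_ac)
  finally show ?thesis .
qed

text \<open>Decomposing only \<open>A\<close> into \<open>ketbra\<close> terms suffices: each term
  yields a value of the nonnegative form of \<open>B\<close>.\<close>

lemma positive_semidefinite_tensor_mat:
  fixes A :: "complex ^ 'n ^ 'n::finite" and B :: "complex ^ 'm ^ 'm::finite"
  assumes "positive_semidefinite A" "positive_semidefinite B"
  shows "positive_semidefinite (tensor_mat A B)"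
proof -
  obtain x :: "'n \<Rightarrow> complex ^ 'n" where A: "A = (\<Sum>k\<in>UNIV. ketbra (x k))"
    using positive_semidefinite_sum_ketbra[OF assms(1)] by blast
  have "hermitian (tensor_mat A B)"
    using assms by (simp add: positive_semidefinite_def hermitian_iff tensor_mat_def)
  moreover have "0 \<le> Re (cinner u (tensor_mat A B *v u))" for u
    using assms(2) unfolding A
    by (simp add: tensor_mat_sum_left matrix_vector_mult_sum_left cinner_sum_right
        cinner_tensor_ketbra positive_semidefinite_def sum_nonneg)
  ultimately show ?thesis by (simp add: positive_semidefinite_def)
qed

lemma density_matrix_product_state: "\<delta> \<in> product_states \<Longrightarrow> density_matrix \<delta>"
  by (auto simp: product_states_def density_matrix_iff positive_semidefinite_tensor_mat trace_tensor_mat)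

lemma product_states_nonempty:
  "product_states \<noteq> ({} :: (complex ^ ('n::finite \<times> 'n) ^ ('n \<times> 'n)) set)"
proof -
  have "density_matrix (ketbra (axis (undefined :: 'n) 1))"
    by (rule density_matrix_ketbra) (simp only: cinner_axis, simp add: axis_def)
  then show ?thesis unfolding product_states_def by blast
qed

section \<open>Von Neumann measurements\<close>

lemma trace_sum:
  fixes A :: "'k \<Rightarrow> complex ^ 'i ^ 'i"
  shows "trace (\<Sum>k\<in>K. A k) = (\<Sum>k\<in>K. trace (A k))"
  unfolding trace_def by (subst sum.swap) simp

lemma trace_mult_sum_right:
  fixes A :: "complex ^ 'i ^ 'i"
  shows "trace (A ** (\<Sum>P\<in>F. P)) = (\<Sum>P\<in>F. trace (A ** P))"
proof -
  have "A ** (\<Sum>P\<in>F. P) = (\<Sum>P\<in>F. A ** P)"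
    by (simp add: vec_eq_iff matrix_matrix_mult_def sum_distrib_left sum.swap[of _ UNIV F])
  then show ?thesis by (simp add: trace_sum)
qed

text \<open>Rank one gives entries \<open>t i * w $ j\<close>, so squaring multiplies every entry by
  \<open>trace P\<close>; idempotence at a nonzero entry fixes this factor.\<close>

lemma trace_rank_one_projector:
  assumes "rank_one_projector P"
  shows "trace P = 1"
proof -
  have PP: "P ** P = P" and dim: "vec.dim (rows P) = 1"
    using assms by (auto simp: rank_one_projector_def row_rank_def_gen)
  obtain B where B: "B \<subseteq> rows P" "\<not> vec.dependent B" "rows P \<subseteq> vec.span B" "card B = 1"
    using vec.basis_exists[of "rows P"] dim by metis
  then obtain w where "B = {w}" by (auto simp: card_1_singleton_iff)
  with B have w: "w \<in> rows P" "w \<noteq> 0" "rows P \<subseteq> range (\<lambda>k. k *s w)"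
    by (auto simp: vec.span_singleton)
  have "\<exists>k. P $ i = k *s w" for i
    using w(3) by (auto simp: rows_def row_def vec_lambda_eta)
  then obtain t where t: "\<And>i. P $ i = t i *s w" by metis
  have entry: "P $ i $ j = t i * w $ j" for i j by (simp add: t)
  have idem: "trace P * (t i * w $ j) = t i * w $ j" for i j
  proof -
    have "(P ** P) $ i $ j = trace P * (t i * w $ j)"
      by (simp add: matrix_matrix_mult_def trace_def entry sum_distrib_left sum_distrib_right mult_ac)
    then show ?thesis by (simp only: PP entry)
  qed
  obtain j where j: "w $ j \<noteq> 0" using w(2) by (auto simp: vec_eq_iff)
  obtain i where "w = P $ i" using w(1) by (auto simp: rows_def row_def vec_lambda_eta)
  then have "t i * w $ j \<noteq> 0" using j entry[of i j] by metis
  then show ?thesis using idem[of i j] by simp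
qed

text \<open>By \<open>P ** P = P\<close> and cyclicity the trace is that of
  \<open>P ** \<rho> ** P\<close>, a sum of values of the form of \<open>\<rho>\<close> at the
  columns of \<open>P\<close>.\<close>

lemma outcome_prob_nonneg:
  assumes "positive_semidefinite \<rho>" "rank_one_projector P"
  shows "0 \<le> outcome_prob \<rho> P"
proof -
  have h: "hermitian P" and PP: "P ** P = P" using assms(2) by (auto simp: rank_one_projector_def)
  have "trace (\<rho> ** P) = trace ((\<rho> ** P) ** P)" by (simp add: PP flip: matrix_mul_assoc)
  also have "\<dots> = trace (P ** (\<rho> ** P))" by (rule trace_mul_sym)
  also have "\<dots> = (\<Sum>i\<in>UNIV. cinner (column i P) (\<rho> *v column i P))"
    by (simp add: trace_def cinner_def matrix_matrix_mult_def matrix_vector_mult_def column_def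
        hermitian_entry[OF h])
  finally show ?thesis
    using assms(1) by (simp add: outcome_prob_def positive_semidefinite_def sum_nonneg)
qed

lemma sum_outcome_prob:
  assumes "trace \<rho> = 1" "von_neumann_measurement \<P>"
  shows "(\<Sum>P\<in>\<P>. outcome_prob \<rho> P) = 1"
proof -
  have "(\<Sum>P\<in>\<P>. outcome_prob \<rho> P) = Re (trace (\<rho> ** (\<Sum>P\<in>\<P>. P)))"
    by (simp add: outcome_prob_def trace_mult_sum_right)
  then show ?thesis using assms by (simp add: von_neumann_measurement_def)
qed

lemma card_von_neumann_measurement:
  fixes \<P> :: "(complex ^ 'i ^ 'i) set"
  assumes "von_neumann_measurement \<P>"
  shows "card \<P> = CARD('i)"
proof -
  have "(of_nat CARD('i) :: complex) = trace (mat 1 :: complex ^ 'i ^ 'i)"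
    by (simp add: trace_def mat_def)
  also have "\<dots> = trace (\<Sum>P\<in>\<P>. P)"
    using assms by (simp add: von_neumann_measurement_def)
  also have "\<dots> = (\<Sum>P\<in>\<P>. trace P)" by (rule trace_sum)
  also have "\<dots> = of_nat (card \<P>)"
    using assms by (simp add: von_neumann_measurement_def trace_rank_one_projector)
  finally show ?thesis by (simp only: of_nat_eq_iff)
qed

text \<open>Each outcome contributes at most \<open>1 / ln 2\<close>. Both bounds are uniform in the
  state and the measurement, so the real supremum and infimum are over bounded sets.\<close>

lemma klein_entropy_bounds:
  fixes \<rho> :: "complex ^ 'i ^ 'i"
  assumes "density_matrix \<rho>" "von_neumann_measurement \<P>"
  shows "0 \<le> klein_entropy \<rho> \<P>" "klein_entropy \<rho> \<P> \<le> CARD('i) / ln 2"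
proof -
  have nonneg: "0 \<le> outcome_prob \<rho> P" if "P \<in> \<P>" for P
    using assms that outcome_prob_nonneg
    by (auto simp: von_neumann_measurement_def density_matrix_iff)
  have fin: "finite \<P>" using assms(2) by (simp add: von_neumann_measurement_def)
  have sum1: "(\<Sum>P\<in>\<P>. outcome_prob \<rho> P) = 1"
    using assms by (intro sum_outcome_prob) (auto simp: density_matrix_iff)
  have "outcome_prob \<rho> P \<le> 1" if "P \<in> \<P>" for P
    using member_le_sum[of P \<P> "outcome_prob \<rho>"] that nonneg fin sum1 by auto
  then show "0 \<le> klein_entropy \<rho> \<P>"
    unfolding klein_entropy_def using nonneg by (simp add: sum_nonpos xlogx_nonpos)
  have "(\<Sum>P\<in>\<P>. - (1 / ln 2)) \<le> (\<Sum>P\<in>\<P>. outcome_prob \<rho> P * log 2 (outcome_prob \<rho> P))"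
    using nonneg by (intro sum_mono xlogx_lower) auto
  then show "klein_entropy \<rho> \<P> \<le> CARD('i) / ln 2"
    by (simp add: klein_entropy_def card_von_neumann_measurement[OF assms(2)])
qed

text \<open>One measurement bounds the supremum from below once the set is bounded above; for this,
  the fixed product state \<open>\<delta>0\<close> bounds every infimum from above.\<close>

lemma entropic_entanglement_ge:
  fixes \<rho> :: "complex ^ ('n::finite \<times> 'n) ^ ('n \<times> 'n)"
  assumes "density_matrix \<rho>" "von_neumann_measurement \<P>"
    and "\<And>\<delta>. \<delta> \<in> product_states \<Longrightarrow> h \<le> klein_entropy \<delta> \<P>"
  shows "h - klein_entropy \<rho> \<P> \<le> entropic_entanglement \<rho>"
proof -
  obtain \<delta>0 :: "complex ^ ('n \<times> 'n) ^ ('n \<times> 'n)" where \<delta>0: "\<delta>0 \<in> product_states"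
    using product_states_nonempty by blast
  have "(INF \<delta>\<in>product_states. klein_entropy \<delta> \<Q>) - klein_entropy \<rho> \<Q>
      \<le> real CARD('n \<times> 'n) / ln 2" if "von_neumann_measurement \<Q>" for \<Q>
  proof -
    have "bdd_below ((\<lambda>\<delta>. klein_entropy \<delta> \<Q>) ` product_states)"
      using klein_entropy_bounds(1)[OF density_matrix_product_state that]
      by (intro bdd_belowI2)
    then have "(INF \<delta>\<in>product_states. klein_entropy \<delta> \<Q>) \<le> klein_entropy \<delta>0 \<Q>"
      using \<delta>0 by (rule cINF_lower)
    then show ?thesis
      using klein_entropy_bounds(2)[OF density_matrix_product_state[OF \<delta>0] that]
        klein_entropy_bounds(1)[OF assms(1) that] by linarith
  qed
  then have "bdd_above ((\<lambda>\<Q>. (INF \<delta>\<in>product_states. klein_entropy \<delta> \<Q>) - klein_entropy \<rho> \<Q>)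
      ` {\<Q>. von_neumann_measurement \<Q>})"
    by (intro bdd_aboveI2) auto
  then have "(INF \<delta>\<in>product_states. klein_entropy \<delta> \<P>) - klein_entropy \<rho> \<P> \<le> entropic_entanglement \<rho>"
    unfolding entropic_entanglement_def using assms(2) by (intro cSUP_upper) auto
  moreover have "h \<le> (INF \<delta>\<in>product_states. klein_entropy \<delta> \<P>)"
    using product_states_nonempty assms(3) by (intro cINF_greatest) auto
  ultimately show ?thesis by linarith
qed

section \<open>Measurements in orthonormal bases\<close>

definition orthonormal :: "('k \<Rightarrow> complex ^ 'i) \<Rightarrow> bool" where
  "orthonormal u \<longleftrightarrow> (\<forall>p q. cinner (u p) (u q) = (if p = q then 1 else 0))"

text \<open>With the \<open>u p\<close> as columns, \<open>U\<close> is square, so its left inverse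
  \<open>conj_transpose U\<close> is also a right inverse.\<close>

lemma sum_ketbra_orthonormal:
  fixes u :: "'i::finite \<Rightarrow> complex ^ 'i"
  assumes "orthonormal u"
  shows "(\<Sum>p\<in>UNIV. ketbra (u p)) = mat 1"
proof -
  define U :: "complex ^ 'i ^ 'i" where "U = (\<chi> i p. u p $ i)"
  have "conj_transpose U ** U = mat 1"
    using assms by (simp add: orthonormal_def vec_eq_iff matrix_matrix_mult_def conj_transpose_def
        U_def mat_def cinner_def)
  then have "U ** conj_transpose U = mat 1" by (simp add: matrix_left_right_inverse)
  then show ?thesis
    by (simp add: vec_eq_iff matrix_matrix_mult_def conj_transpose_def U_def ketbra_def)
qed

lemma ketbra_mult_ketbra: "ketbra u ** ketbra w = (\<chi> i j. cinner u w * (u $ i * cnj (w $ j)))"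
  by (simp add: vec_eq_iff matrix_matrix_mult_def ketbra_def cinner_def sum_distrib_left
      sum_distrib_right mult_ac)

lemma rank_ketbra:
  assumes "u \<noteq> 0"
  shows "rank (ketbra u) = 1"
proof -
  define w :: "complex ^ 'a" where "w = (\<chi> j. cnj (u $ j))"
  have row: "row i (ketbra u) = u $ i *s w" for i
    by (simp add: vec_eq_iff row_def ketbra_def w_def)
  obtain i where i: "u $ i \<noteq> 0" using assms by (auto simp: vec_eq_iff)
  then have "w \<noteq> 0" by (auto simp: w_def vec_eq_iff)
  have "vec.span (rows (ketbra u)) = vec.span {w}"
  proof (rule antisym)
    show "vec.span (rows (ketbra u)) \<subseteq> vec.span {w}"
      by (rule vec.span_minimal)
        (auto simp: rows_def row vec.subspace_span intro: vec.span_scale vec.span_base)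
    have "w = inverse (u $ i) *s row i (ketbra u)" using i by (simp add: row)
    also have "\<dots> \<in> vec.span (rows (ketbra u))"
      by (intro vec.span_scale vec.span_base) (auto simp: rows_def)
    finally show "vec.span {w} \<subseteq> vec.span (rows (ketbra u))"
      by (intro vec.span_minimal) (auto simp: vec.subspace_span)
  qed
  then have "vec.dim (rows (ketbra u)) = vec.dim {w}" by (metis vec.dim_span)
  also have "\<dots> = 1" using \<open>w \<noteq> 0\<close> by (subst vec.dim_eq_card_independent) auto
  finally show ?thesis by (simp add: row_rank_def_gen)
qed

text \<open>The trace of \<open>ketbra (u p) ** ketbra (u q)\<close> tells equal from distinct
  indices. Sums over the set of projectors can then be taken over indices.\<close>

lemma inj_ketbra_orthonormal:
  assumes "orthonormal u"
  shows "inj (\<lambda>p. ketbra (u p))"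
proof (rule injI)
  fix p q assume "ketbra (u p) = ketbra (u q)"
  then have "trace (ketbra (u p) ** ketbra (u p)) = trace (ketbra (u p) ** ketbra (u q))" by simp
  then show "p = q" using assms
    by (auto simp: trace_mult_ketbra ketbra_mult_vec cinner_scale_right orthonormal_def split: if_splits)
qed

lemma von_neumann_measurement_orthonormal:
  fixes u :: "'i::finite \<Rightarrow> complex ^ 'i"
  assumes "orthonormal u"
  shows "von_neumann_measurement (range (\<lambda>p. ketbra (u p)))"
  unfolding von_neumann_measurement_def
proof (intro conjI ballI impI)
  have u: "cinner (u p) (u q) = (if p = q then 1 else 0)" for p q
    using assms by (simp add: orthonormal_def)
  show "finite (range (\<lambda>p. ketbra (u p)))" by simp
  show "rank_one_projector P" if P: "P \<in> range (\<lambda>p. ketbra (u p))" for P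
  proof -
    obtain p where p: "P = ketbra (u p)" using P by auto
    have "u p \<noteq> 0" using u[of p p] by auto
    moreover have "ketbra (u p) ** ketbra (u p) = ketbra (u p)"
      by (simp add: ketbra_mult_ketbra u) (simp add: ketbra_def)
    ultimately show ?thesis
      by (simp add: p rank_one_projector_def hermitian_ketbra rank_ketbra)
  qed
  show "P ** Q = 0" if "P \<in> range (\<lambda>p. ketbra (u p))" "Q \<in> range (\<lambda>p. ketbra (u p))" "P \<noteq> Q" for P Q
    using that by (auto simp: ketbra_mult_ketbra u vec_eq_iff)
  show "(\<Sum>P\<in>range (\<lambda>p. ketbra (u p)). P) = mat 1"
    using sum_ketbra_orthonormal[OF assms]
    by (simp add: sum.reindex[OF inj_ketbra_orthonormal[OF assms]])
qed

section \<open>Product states measured in the twisted basis\<close>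

lemma sum_cinner_orthonormal:
  fixes u :: "'i::finite \<Rightarrow> complex ^ 'i"
  assumes "orthonormal u"
  shows "(\<Sum>p\<in>UNIV. cinner (u p) (A *v u p)) = trace A"
proof -
  have "(\<Sum>p\<in>UNIV. cinner (u p) (A *v u p)) = (\<Sum>P\<in>range (\<lambda>p. ketbra (u p)). trace (A ** P))"
    by (simp add: sum.reindex[OF inj_ketbra_orthonormal[OF assms]] trace_mult_ketbra)
  also have "\<dots> = trace (A ** mat 1)"
    using von_neumann_measurement_orthonormal[OF assms]
    by (simp only: trace_mult_sum_right[symmetric] von_neumann_measurement_def)
  finally show ?thesis by simp
qed

text \<open>Cauchy-Schwarz twice: first entrywise for the two density matrices in the local bases, then for
  the diagonals, which are probability vectors.\<close>

lemma product_outcome_le: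
  fixes e f :: "'n::finite \<Rightarrow> complex ^ 'n" and b :: "'n \<Rightarrow> real"
  assumes "orthonormal e" "orthonormal f" "inj \<pi>" "\<And>i. (b i)\<^sup>2 \<le> c" "\<delta> \<in> product_states"
  shows "outcome_prob \<delta> (ketbra (\<Sum>i\<in>UNIV. of_real (b i) *s tensor_vec (e i) (f (\<pi> i)))) \<le> c"
proof -
  obtain A B where \<delta>: "\<delta> = tensor_mat A B" and "density_matrix A" "density_matrix B"
    using assms(5) by (auto simp: product_states_def)
  then have A: "positive_semidefinite A" "trace A = 1" and B: "positive_semidefinite B" "trace B = 1"
    by (auto simp: density_matrix_iff)
  define x where "x i j = cinner (e i) (A *v e j)" for i j
  define y where "y i j = cinner (f (\<pi> i)) (B *v f (\<pi> j))" for i j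
  have x0: "0 \<le> Re (x i i)" and y0: "0 \<le> Re (y i i)" for i
    using A B by (auto simp: positive_semidefinite_def x_def y_def)
  have x_le: "cmod (x i j) \<le> sqrt (Re (x i i)) * sqrt (Re (x j j))" for i j
    unfolding x_def real_sqrt_mult[symmetric]
    by (intro real_le_rsqrt positive_semidefinite_Cauchy_Schwarz A)
  have y_le: "cmod (y i j) \<le> sqrt (Re (y i i)) * sqrt (Re (y j j))" for i j
    unfolding y_def real_sqrt_mult[symmetric]
    by (intro real_le_rsqrt positive_semidefinite_Cauchy_Schwarz B)
  have "(\<Sum>i\<in>UNIV. x i i) = 1" using sum_cinner_orthonormal[OF assms(1), of A] A(2) by (simp add: x_def)
  then have x1: "(\<Sum>i\<in>UNIV. Re (x i i)) = 1" by (simp flip: Re_sum)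
  have "bij \<pi>" using assms(3) by (simp add: finite_UNIV_inj_surj bij_def)
  then have "(\<Sum>i\<in>UNIV. y i i) = 1"
    using sum_cinner_orthonormal[OF assms(2), of B] B(2)
      sum.reindex_bij_betw[of \<pi> UNIV UNIV "\<lambda>i. cinner (f i) (B *v f i)"] by (simp add: y_def)
  then have y1: "(\<Sum>i\<in>UNIV. Re (y i i)) = 1" by (simp flip: Re_sum)
  \<comment> \<open>\<open>r\<close> multiplies the square roots of two probability vectors, so
    Cauchy-Schwarz bounds its sum by 1.\<close>
  define r where "r i = sqrt (Re (x i i)) * sqrt (Re (y i i))" for i
  have r0: "0 \<le> r i" for i using x0 y0 by (simp add: r_def)
  have "(\<Sum>i\<in>UNIV. r i)\<^sup>2 \<le> (\<Sum>i\<in>UNIV. (sqrt (Re (x i i)))\<^sup>2) * (\<Sum>i\<in>UNIV. (sqrt (Re (y i i)))\<^sup>2)"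
    unfolding r_def by (rule Cauchy_Schwarz_ineq_sum)
  then have r1: "(\<Sum>i\<in>UNIV. r i)\<^sup>2 \<le> 1" using x0 y0 x1 y1 by simp
  \<comment> \<open>\<open>undefined\<close> stands for an arbitrary index.\<close>
  have "0 \<le> c" using assms(4)[of undefined] zero_le_power2 order_trans by blast
  have b: "\<bar>b i\<bar> \<le> sqrt c" for i using assms(4)[of i] by (simp add: real_le_rsqrt)
  have "outcome_prob \<delta> (ketbra (\<Sum>i\<in>UNIV. of_real (b i) *s tensor_vec (e i) (f (\<pi> i)))) =
      Re (\<Sum>i\<in>UNIV. \<Sum>j\<in>UNIV. of_real (b i) * (of_real (b j) * (x j i * y j i)))"
    by (simp add: outcome_prob_def trace_mult_ketbra \<delta> vector_scalar_commute
        tensor_mat_mult_tensor_vec cinner_sum_left cinner_sum_right cinner_scale_left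
        cinner_scale_right cinner_tensor_vec x_def y_def matrix_vector_mult_sum_right
        sum_distrib_left del: Re_sum)
  also have "\<dots> \<le> (\<Sum>i\<in>UNIV. \<Sum>j\<in>UNIV. cmod (of_real (b i) * (of_real (b j) * (x j i * y j i))))"
    by (intro order_trans[OF complex_Re_le_cmod] order_trans[OF norm_sum] sum_mono norm_sum)
  \<comment> \<open>The bounds on \<open>x\<close> and \<open>y\<close> regroup into
    \<open>r i * r j\<close>, so the majorant factors and the double sum becomes a square.\<close>
  also have "\<dots> \<le> (\<Sum>i\<in>UNIV. \<Sum>j\<in>UNIV. (sqrt c * r i) * (sqrt c * r j))"
  proof (intro sum_mono)
    fix i j
    have xy: "cmod (x j i) * cmod (y j i) \<le> r i * r j"
      using mult_mono[OF x_le[of j i] y_le[of j i]] x0 y0 by (simp add: r_def mult_ac)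
    have bb: "\<bar>b i\<bar> * \<bar>b j\<bar> \<le> sqrt c * sqrt c"
      using b \<open>0 \<le> c\<close> by (intro mult_mono) auto
    have "(\<bar>b i\<bar> * \<bar>b j\<bar>) * (cmod (x j i) * cmod (y j i)) \<le> (sqrt c * sqrt c) * (r i * r j)"
      using \<open>0 \<le> c\<close> by (intro mult_mono[OF bb xy]) auto
    then show "cmod (of_real (b i) * (of_real (b j) * (x j i * y j i))) \<le> (sqrt c * r i) * (sqrt c * r j)"
      by (simp only: norm_mult norm_of_real mult_ac)
  qed
  also have "\<dots> = c * (\<Sum>i\<in>UNIV. r i)\<^sup>2"
  proof -
    have "(\<Sum>i\<in>UNIV. \<Sum>j\<in>UNIV. (sqrt c * r i) * (sqrt c * r j)) = (sqrt c * sum r UNIV)\<^sup>2"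
      unfolding power2_eq_square sum_distrib_left[of "sqrt c"] by (rule sum_product[symmetric])
    then show ?thesis using \<open>0 \<le> c\<close> by (simp add: power_mult_distrib)
  qed
  also have "\<dots> \<le> c" using mult_left_mono[OF r1 \<open>0 \<le> c\<close>] by simp
  finally show ?thesis .
qed

text \<open>Orthonormality of \<open>e\<close> leaves only equal indices \<open>i\<close>;
  injectivity of \<open>oplus i\<close> then makes the \<open>f\<close> factor vanish unless the
  shifts agree, and the rows of \<open>v\<close> settle the rest.\<close>

lemma orthonormal_twisted:
  fixes e f :: "'n::finite \<Rightarrow> complex ^ 'n" and v :: "'n \<Rightarrow> 'n \<Rightarrow> real"
    and oplus :: "'n \<Rightarrow> 'n \<Rightarrow> 'n"
  assumes "orthonormal e" "orthonormal f"
    and "\<And>g h. (\<Sum>i\<in>UNIV. v g i * v h i) = (if g = h then 1 else 0)"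
    and "\<And>i. inj (oplus i)"
  shows "orthonormal (\<lambda>p. \<Sum>i\<in>UNIV. of_real (v (fst p) i) *s tensor_vec (e i) (f (oplus i (snd p))))"
  unfolding orthonormal_def
proof (intro allI)
  fix p q :: "'n \<times> 'n"
  let ?\<psi> = "\<lambda>p. \<Sum>i\<in>UNIV. of_real (v (fst p) i) *s tensor_vec (e i) (f (oplus i (snd p)))"
  have e: "cinner (e i) (e j) = (if i = j then 1 else 0)"
    and f: "cinner (f i) (f j) = (if i = j then 1 else 0)" for i j
    using assms(1,2) by (simp_all add: orthonormal_def)
  have f': "cinner (f (oplus i g)) (f (oplus i h)) = (if g = h then 1 else 0)" for i g h
    using assms(4)[of i] by (auto simp: f dest: injD)
  have "cinner (?\<psi> p) (?\<psi> q) = (\<Sum>i\<in>UNIV. \<Sum>j\<in>UNIV. if i = j then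
      of_real (v (fst p) i) * of_real (v (fst q) i) * (if snd p = snd q then 1 else 0) else 0)"
    by (simp add: cinner_sum_left cinner_sum_right cinner_scale_left cinner_scale_right
        cinner_tensor_vec e f' sum_distrib_left if_distrib cong: if_cong)
      (auto intro!: sum.cong simp: f')
  also have "\<dots> = of_real (\<Sum>i\<in>UNIV. v (fst p) i * v (fst q) i) * (if snd p = snd q then 1 else 0)"
    by (simp add: sum_distrib_right)
  also have "\<dots> = (if p = q then 1 else 0)" by (auto simp: assms(3) prod_eq_iff)
  finally show "cinner (?\<psi> p) (?\<psi> q) = (if p = q then 1 else 0)" .
qed

text \<open>The outcome belonging to \<open>p\<close> is certain.\<close>

lemma klein_entropy_orthonormal_member:
  fixes u :: "'i::finite \<Rightarrow> complex ^ 'i"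
  assumes "orthonormal u"
  shows "klein_entropy (ketbra (u p)) (range (\<lambda>p. ketbra (u p))) = 0"
proof -
  have "outcome_prob (ketbra (u p)) (ketbra (u q)) = (if p = q then 1 else 0)" for q
    using assms by (simp add: outcome_prob_def trace_mult_ketbra ketbra_mult_vec cinner_scale_right
        orthonormal_def)
  then show ?thesis
    unfolding klein_entropy_def
    by (simp add: sum.reindex[OF inj_ketbra_orthonormal[OF assms]] sum.neutral)
qed

theorem proposition7:
  fixes \<phi> :: "complex ^ ('n::finite \<times> 'n)"
    and a :: "'n \<Rightarrow> real"
    and e f :: "'n \<Rightarrow> complex ^ 'n"
    and c :: real and k :: nat
  assumes "CARD('n) \<in> {2, 4, 8}"
    and "norm \<phi> = 1"
    and "schmidt_decomposition \<phi> a e f"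
    and "c = Max (range (\<lambda>i. (a i)\<^sup>2))"
    and "k = nat \<lfloor>1 / c\<rfloor>"
  shows "entropic_entanglement (ketbra \<phi>) \<ge> shannon_entropy (replicate k c @ [1 - real k * c]) \<and>
    shannon_entropy (replicate k c @ [1 - real k * c]) =
      - real k * c * log 2 c - (1 - real k * c) * log 2 (1 - real k * c)"
proof
  have ef: "orthonormal e" "orthonormal f" and a1: "(\<Sum>i\<in>UNIV. (a i)\<^sup>2) = 1"
    and \<phi>: "\<phi> = (\<Sum>i\<in>UNIV. of_real (a i) *s tensor_vec (e i) (f i))"
    using assms(3) by (auto simp: schmidt_decomposition_def orthonormal_basis_def orthonormal_def)
  have ac: "(a i)\<^sup>2 \<le> c" for i unfolding assms(4) by (rule Max_ge) auto
  have "0 < c"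
  proof (rule ccontr)
    assume "\<not> 0 < c"
    then have "(a i)\<^sup>2 = 0" for i using ac[of i] zero_le_power2[of "a i"] by linarith
    then show False using a1 by simp
  qed
  obtain oplus :: "'n \<Rightarrow> 'n \<Rightarrow> 'n" and z :: 'n and v :: "'n \<Rightarrow> 'n \<Rightarrow> real" where
    G: "\<And>x. oplus x z = x" "\<And>x. inj (oplus x)" "\<And>x. inj (\<lambda>y. oplus y x)"
    and v: "v z = a" "\<And>g i. \<exists>j. (v g i)\<^sup>2 = (a j)\<^sup>2"
    "\<And>g h. (\<Sum>i\<in>UNIV. v g i * v h i) = (if g = h then \<Sum>i\<in>UNIV. (a i)\<^sup>2 else 0)"
    by (rule ex_signed_permutation_frame[OF assms(1), where a = a]) (rule that)
  \<comment> \<open>The first component of \<open>p\<close> picks a signed rearrangement of the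
    coefficients, the second a shift of the \<open>f\<close> vectors.\<close>
  define u where
    "u p = (\<Sum>i\<in>UNIV. of_real (v (fst p) i) *s tensor_vec (e i) (f (oplus i (snd p))))" for p
  have u: "orthonormal u"
    unfolding u_def[abs_def] using ef G(2) v(3) a1 by (intro orthonormal_twisted) auto
  have u\<phi>: "u (z, z) = \<phi>" by (simp add: u_def \<phi> G(1) v(1))
  have vn: "von_neumann_measurement (range (\<lambda>p. ketbra (u p)))"
    by (rule von_neumann_measurement_orthonormal[OF u])
  have vc: "(v g i)\<^sup>2 \<le> c" for g i using v(2)[of g i] ac by metis
  have low: "shannon_entropy (replicate k c @ [1 - real k * c])
      \<le> klein_entropy \<delta> (range (\<lambda>p. ketbra (u p)))" if \<delta>: "\<delta> \<in> product_states" for \<delta>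
  proof -
    have d: "density_matrix \<delta>" using \<delta> by (rule density_matrix_product_state)
    have "(\<Sum>P\<in>range (\<lambda>p. ketbra (u p)). outcome_prob \<delta> P * log 2 (outcome_prob \<delta> P)) \<le>
      real k * c * log 2 c + (1 - real k * c) * log 2 (1 - real k * c)"
    proof (rule sum_xlogx_le)
      show "finite (range (\<lambda>p. ketbra (u p)))" by simp
      show "0 \<le> outcome_prob \<delta> P" if "P \<in> range (\<lambda>p. ketbra (u p))" for P
        using d vn that by (auto simp: density_matrix_iff von_neumann_measurement_def intro!: outcome_prob_nonneg)
      \<comment> \<open>The shift \<open>i \<mapsto> oplus i h\<close> plays the role of
        \<open>\<pi>\<close>; \<open>G(3)\<close> supplies its injectivity.\<close>
      show "outcome_prob \<delta> P \<le> c" if "P \<in> range (\<lambda>p. ketbra (u p))" for P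
        using that \<delta> unfolding u_def by (auto intro!: product_outcome_le ef G(3) vc)
      show "(\<Sum>P\<in>range (\<lambda>p. ketbra (u p)). outcome_prob \<delta> P) = 1"
        using d vn by (intro sum_outcome_prob) (auto simp: density_matrix_iff)
    qed (use \<open>0 < c\<close> assms(5) in auto)
    then show ?thesis by (simp add: klein_entropy_def shannon_entropy_blocks)
  qed
  have "density_matrix (ketbra \<phi>)"
    using u by (intro density_matrix_ketbra) (simp add: orthonormal_def flip: u\<phi>)
  \<comment> \<open>\<open>\<phi>\<close> is the basis vector at \<open>(z, z)\<close>, so its
    entropy is 0 and the bound for product states carries over in full.\<close>
  from entropic_entanglement_ge[OF this vn low] klein_entropy_orthonormal_member[OF u, of "(z, z)"]
  show "entropic_entanglement (ketbra \<phi>) \<ge> shannon_entropy (replicate k c @ [1 - real k * c])"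
    by (simp add: u\<phi>)
qed (rule shannon_entropy_blocks)

end
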